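(* Let $\gamma:[0,\ell_\gamma]\to\mathbb R$ be a normalized profile function such that $\gamma(t)=\gamma(\ell_\gamma-t)$ for all $t$, and suppose that the Gaussian curvature $K$ of the associated surface of revolution $S^2_\gamma$, as a function of $t$, is increasing for $t\in[0,\ell_\gamma/2]$. Then $m_\gamma\le1$ and $\mathcal C_\gamma=(0,+\infty)$.
   Context: A normalized profile function is a smooth $\gamma:[0,\ell_\gamma]\to\mathbb R$ such that: (1) $\gamma(0)=\gamma(\ell_\gamma)=0$ and $\gamma>0$ otherwise; (2) $\dot\gamma(0)=1$, $\dot\gamma(\ell_\gamma)=-1$ and $|\dot\gamma|<1$ on $(0,\ell_\gamma)$; (3) all even derivatives of $\gamma$ vanish at $0$ and $\ell_\gamma$; (4) $\int_0^{\ell_\gamma}\gamma(t)\,dt=2$. The surface of revolution $S^2_\gamma$ is the sphere obtained from $[0,\ell_\gamma]\times\mathbb R/2\pi\mathbb Z$ with coordinates $(t,\theta)$ by collapsing $\{0\}\times\mathbb R/2\pi\mathbb Z$ and $\{\ell_\gamma\}\times\mathbb R/2\pi\mathbb Z$ to points, with metric $g_\gamma=dt^2+\gamma(t)^2d\theta^2$; its area form is $\mu_\gamma=\gamma\,dt\wedge d\theta$ (total area $4\pi$) and its Gaussian curvature is $K=-\ddot\gamma/\gamma$. "Increasing" is meant in the weak sense (nondecreasing). Let $\mathcal P$ be the set of 1-forms $\beta$ on $S^2_\gamma$ with $d\beta=(1-K)\mu_\gamma$. Then $m_\gamma:=\inf_{\beta\in\mathcal P}\sup_{x}|\beta_x|$,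 where $|\cdot|$ is the norm dual to $g_\gamma$, and $$\mathcal C_\gamma:=\Big\{m>0\ \Big|\ m>\inf_{\beta\in\mathcal P}\sup_{x\in S^2_\gamma}\Big(|\beta_x|-\frac1m\Big)\Big\}.$$ *)

theory Defs
  imports "HOL-Analysis.Analysis"
begin

section \<open>Normalized profile functions\<close>

text \<open>
  A profile function on \<open>[0, L]\<close> is a function \<open>real \<Rightarrow> real\<close> of which only the values on
  \<open>{0..L}\<close> matter; at the end points derivatives are one-sided.
\<close>

fun deriv_iter :: "real \<Rightarrow> (real \<Rightarrow> real) \<Rightarrow> nat \<Rightarrow> real \<Rightarrow> real" where
  "deriv_iter L \<gamma> 0 = \<gamma>"
| "deriv_iter L \<gamma> (Suc n) =
     (\<lambda>t. vector_derivative (deriv_iter L \<gamma> n) (at t within {0..L}))"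

definition smooth_on_interval :: "real \<Rightarrow> (real \<Rightarrow> real) \<Rightarrow> bool" where
  "smooth_on_interval L \<gamma> \<longleftrightarrow> (\<forall>n. deriv_iter L \<gamma> n differentiable_on {0..L})"

definition normalized_profile :: "real \<Rightarrow> (real \<Rightarrow> real) \<Rightarrow> bool" where
  "normalized_profile L \<gamma> \<longleftrightarrow>
     0 < L \<and> smooth_on_interval L \<gamma> \<and>
     \<gamma> 0 = 0 \<and> \<gamma> L = 0 \<and> (\<forall>t\<in>{0<..<L}. \<gamma> t > 0) \<and>
     deriv_iter L \<gamma> 1 0 = 1 \<and> deriv_iter L \<gamma> 1 L = -1 \<and>
     (\<forall>t\<in>{0<..<L}. \<bar>deriv_iter L \<gamma> 1 t\<bar> < 1) \<and>
     (\<forall>n. deriv_iter L \<gamma> (2 * n) 0 = 0 \<and> deriv_iter L \<gamma> (2 * n) L = 0) \<and>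
     integral {0..L} \<gamma> = 2"

text \<open>
  The Gaussian curvature as a function of \<open>t \<in> [0, L]\<close>. At the poles, where the formula is
  \<open>0 / 0\<close>, the curvature is the continuous extension.
\<close>

definition gauss_curvature :: "real \<Rightarrow> (real \<Rightarrow> real) \<Rightarrow> real \<Rightarrow> real" where
  "gauss_curvature L \<gamma> t =
     (let K = (\<lambda>s. - deriv_iter L \<gamma> 2 s / \<gamma> s)
      in if t \<in> {0<..<L} then K t else Lim (at t within {0<..<L}) K)"


section \<open>The surface of revolution\<close>

text \<open>
  The sphere obtained from \<open>[0, L] \<times> \<real>/2\<pi>\<int>\<close> by collapsing the two boundary circles is described
  by its atlas of two charts, one around each pole. Both charts take values in the open disc
  \<open>ball 0 L\<close> of the plane; the point with coordinates \<open>(t, \<theta>)\<close> corresponds to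
  \<open>t (cos \<theta>, sin \<theta>)\<close> in the chart \<open>North\<close> (all points with \<open>t < L\<close>) and to
  \<open>(L - t) (cos \<theta>, sin \<theta>)\<close> in the chart \<open>South\<close> (all points with \<open>t > 0\<close>).
  A point of the surface is thus given by a chart and a point of the disc.
\<close>

type_synonym plane = "real \<times> real"

datatype pole = North | South

definition chart_point :: "real \<Rightarrow> pole \<Rightarrow> real \<Rightarrow> real \<Rightarrow> plane" where
  "chart_point L p t \<theta> = (case p of North \<Rightarrow> t | South \<Rightarrow> L - t) *\<^sub>R (cos \<theta>, sin \<theta>)"

definition transition :: "real \<Rightarrow> plane \<Rightarrow> plane" where
  "transition L x = ((L - norm x) / norm x) *\<^sub>R x"

lemma transition_chart_point:
  assumes "0 < t" "t < L"
  shows "transition L (chart_point L North t \<theta>) = chart_point L South t \<theta>"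
proof -
  have "norm (cos \<theta>, sin \<theta>) = 1"
    by (simp add: norm_Pair)
  then show ?thesis
    using assms by (simp add: transition_def chart_point_def del: scaleR_Pair)
qed

text \<open>The coordinate \<open>t\<close> and the 1-forms \<open>dt\<close> and \<open>d\<theta>\<close> (away from the pole) in a chart.\<close>

definition coord_t :: "real \<Rightarrow> pole \<Rightarrow> plane \<Rightarrow> real" where
  "coord_t L p x = (case p of North \<Rightarrow> norm x | South \<Rightarrow> L - norm x)"

definition orient :: "pole \<Rightarrow> real" where
  "orient p = (case p of North \<Rightarrow> 1 | South \<Rightarrow> -1)"

definition det2 :: "plane \<Rightarrow> plane \<Rightarrow> real" where
  "det2 v w = fst v * snd w - snd v * fst w"

definition form_dt :: "pole \<Rightarrow> plane \<Rightarrow> plane \<Rightarrow> real" where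
  "form_dt p x v = orient p * (x \<bullet> v) / norm x"

definition form_dtheta :: "plane \<Rightarrow> plane \<Rightarrow> real" where
  "form_dtheta x v = det2 x v / (norm x)\<^sup>2"

text \<open>
  The metric \<open>dt\<^sup>2 + \<gamma>(t)\<^sup>2 d\<theta>\<^sup>2\<close> and the area form \<open>\<gamma> dt \<and> d\<theta>\<close> in a chart. Their continuous
  extensions to the pole are the Euclidean metric and, since \<open>t = L - |x|\<close> reverses the
  orientation in the chart \<open>South\<close>, plus or minus the Euclidean area form.
\<close>

definition metric :: "real \<Rightarrow> (real \<Rightarrow> real) \<Rightarrow> pole \<Rightarrow> plane \<Rightarrow> plane \<Rightarrow> plane \<Rightarrow> real" where
  "metric L \<gamma> p x v w =
     (if x = 0 then v \<bullet> w
      else form_dt p x v * form_dt p x w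
           + (\<gamma> (coord_t L p x))\<^sup>2 * (form_dtheta x v * form_dtheta x w))"

definition area_form :: "real \<Rightarrow> (real \<Rightarrow> real) \<Rightarrow> pole \<Rightarrow> plane \<Rightarrow> plane \<Rightarrow> plane \<Rightarrow> real" where
  "area_form L \<gamma> p x v w =
     (if x = 0 then orient p * det2 v w
      else \<gamma> (coord_t L p x) * (form_dt p x v * form_dtheta x w - form_dt p x w * form_dtheta x v))"

text \<open>The coordinate vector fields \<open>\<partial>\<^sub>t\<close> and \<open>\<partial>\<^sub>\<theta>\<close> are dual to the two 1-forms.\<close>

lemma coordinate_forms:
  fixes p :: pole and t \<theta> L :: real
  assumes "0 < t" "t < L"
  defines "c \<equiv> chart_point L p"
  defines "X \<equiv> vector_derivative (\<lambda>s. c s \<theta>) (at t)"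
    and "Y \<equiv> vector_derivative (c t) (at \<theta>)"
  shows "coord_t L p (c t \<theta>) = t"
    "form_dt p (c t \<theta>) X = 1" "form_dt p (c t \<theta>) Y = 0"
    "form_dtheta (c t \<theta>) X = 0" "form_dtheta (c t \<theta>) Y = 1"
proof -
  define r where "r = (case p of North \<Rightarrow> t | South \<Rightarrow> L - t)"
  have r: "r > 0" using assms by (cases p) (auto simp: r_def)
  have c: "c t \<theta> = (r * cos \<theta>, r * sin \<theta>)" by (simp add: c_def chart_point_def r_def)
  have n: "norm (c t \<theta>) = r"
    using r by (simp add: c norm_Pair power_mult_distrib flip: distrib_left)
  have X: "X = (orient p * cos \<theta>, orient p * sin \<theta>)"
    unfolding X_def c_def chart_point_def orient_def
    by (rule vector_derivative_at, cases p)
       (auto intro!: derivative_eq_intros has_vector_derivative_Pair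
             simp flip: has_real_derivative_iff_has_vector_derivative)
  have Y: "Y = (- (r * sin \<theta>), r * cos \<theta>)"
    unfolding Y_def c_def chart_point_def r_def[symmetric]
    by (rule vector_derivative_at)
       (auto intro!: derivative_eq_intros has_vector_derivative_Pair
             simp flip: has_real_derivative_iff_has_vector_derivative)
  have o: "orient p * orient p = 1" by (cases p) (auto simp: orient_def)
  have sc: "cos \<theta> * cos \<theta> + sin \<theta> * sin \<theta> = 1"
    using sin_cos_squared_add3 by simp
  show "coord_t L p (c t \<theta>) = t"
    unfolding coord_t_def n by (cases p) (auto simp: r_def)
  have "orient p * (c t \<theta> \<bullet> X) = (orient p * orient p) * r * (cos \<theta> * cos \<theta> + sin \<theta> * sin \<theta>)"
    unfolding c X inner_Pair inner_real_def by algebra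
  then show "form_dt p (c t \<theta>) X = 1"
    using r by (simp add: form_dt_def n o sc)
  show "form_dt p (c t \<theta>) Y = 0" by (simp add: form_dt_def c Y)
  show "form_dtheta (c t \<theta>) X = 0" by (simp add: form_dtheta_def det2_def c X)
  have "det2 (c t \<theta>) Y = r\<^sup>2 * (cos \<theta> * cos \<theta> + sin \<theta> * sin \<theta>)"
    unfolding det2_def c Y fst_conv snd_conv by algebra
  then show "form_dtheta (c t \<theta>) Y = 1"
    using r by (simp add: form_dtheta_def n sc)
qed


section \<open>Differential 1-forms on the surface\<close>

fun Ck_on :: "nat \<Rightarrow> 'a::real_normed_vector set \<Rightarrow> ('a \<Rightarrow> 'b::real_normed_vector) \<Rightarrow> bool" where
  "Ck_on 0 S f \<longleftrightarrow> continuous_on S f"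
| "Ck_on (Suc k) S f \<longleftrightarrow>
     (\<forall>x\<in>S. f differentiable (at x)) \<and>
     (\<forall>v. Ck_on k S (\<lambda>x. frechet_derivative f (at x) v))"

definition smooth_on :: "'a::real_normed_vector set \<Rightarrow> ('a \<Rightarrow> 'b::real_normed_vector) \<Rightarrow> bool" where
  "smooth_on S f \<longleftrightarrow> (\<forall>k. Ck_on k S f)"

text \<open>
  A smooth 1-form is given by its expressions in the two charts, which must be related by
  pullback along the transition map. Values outside the disc are irrelevant.
\<close>

type_synonym form1 = "pole \<Rightarrow> plane \<Rightarrow> plane \<Rightarrow>\<^sub>L real"

definition one_form :: "real \<Rightarrow> form1 \<Rightarrow> bool" where
  "one_form L \<beta> \<longleftrightarrow>
     (\<forall>p. smooth_on (ball 0 L) (\<beta> p)) \<and>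
     (\<forall>x\<in>ball 0 L - {0}. \<forall>v.
        \<beta> North x v = \<beta> South (transition L x) (frechet_derivative (transition L) (at x) v))"

definition ext_deriv :: "form1 \<Rightarrow> pole \<Rightarrow> plane \<Rightarrow> plane \<Rightarrow> plane \<Rightarrow> real" where
  "ext_deriv \<beta> p x v w =
     frechet_derivative (\<beta> p) (at x) v w - frechet_derivative (\<beta> p) (at x) w v"

definition dual_norm :: "real \<Rightarrow> (real \<Rightarrow> real) \<Rightarrow> form1 \<Rightarrow> pole \<Rightarrow> plane \<Rightarrow> real" where
  "dual_norm L \<gamma> \<beta> p x = (SUP v\<in>{v. metric L \<gamma> p x v v \<le> 1}. \<bar>\<beta> p x v\<bar>)"

definition primitives :: "real \<Rightarrow> (real \<Rightarrow> real) \<Rightarrow> form1 set" where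
  "primitives L \<gamma> = {\<beta>. one_form L \<beta> \<and>
     (\<forall>p. \<forall>x\<in>ball 0 L. \<forall>v w.
        ext_deriv \<beta> p x v w
        = (1 - gauss_curvature L \<gamma> (coord_t L p x)) * area_form L \<gamma> p x v w)}"

text \<open>
  Suprema over the surface run over both charts. They and the infima are taken in the extended
  reals, so no finiteness or nonemptiness is presupposed.
\<close>

definition m_value :: "real \<Rightarrow> (real \<Rightarrow> real) \<Rightarrow> ereal" where
  "m_value L \<gamma> =
     (INF \<beta>\<in>primitives L \<gamma>. SUP (p, x)\<in>UNIV \<times> ball 0 L. ereal (dual_norm L \<gamma> \<beta> p x))"

definition C_set :: "real \<Rightarrow> (real \<Rightarrow> real) \<Rightarrow> real set" where
  "C_set L \<gamma> =
     {m. m > 0 \<and>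
         ereal m > (INF \<beta>\<in>primitives L \<gamma>.
                      SUP (p, x)\<in>UNIV \<times> ball 0 L. ereal (dual_norm L \<gamma> \<beta> p x - 1 / m))}"

end

theory Submission
  imports Defs
begin

text \<open>
  Set \<open>f(t) = \<integral>\<^sub>0\<^sup>t \<gamma> + \<gamma>'(t) - 1\<close>. Since \<open>f' = \<gamma> + \<gamma>'' = (1 - K) \<gamma>\<close>, the form \<open>\<beta> = f d\<theta>\<close> is a
  primitive with \<open>|\<beta>| = |f| / \<gamma>\<close>. Monotonicity of \<open>K\<close> gives \<open>\<gamma>'' \<le> 0\<close> on \<open>[0, L/2]\<close>, and \<open>f \<ge> 0\<close>
  there because \<open>f\<close> first increases and then decreases to \<open>f(L/2) = 0\<close>. Where \<open>\<gamma>' \<le> \<gamma>\<close>, the bound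
  \<open>f \<le> \<gamma>\<close> follows from \<open>\<integral>\<^sub>0\<^sup>t \<gamma> \<le> 1\<close>; elsewhere \<open>\<gamma>' \<ge> \<gamma>\<close> on all of \<open>[0, t]\<close>, so
  \<open>(\<gamma> - f)' = \<gamma>' - \<gamma> - \<gamma>'' \<ge> 0\<close> on it. As \<open>f\<close> is odd about \<open>L/2\<close>, \<open>|\<beta>| \<le> 1\<close> everywhere, and
  \<open>1 - 1/m < m\<close> for all \<open>m > 0\<close>. At the poles \<open>\<beta>\<close> is smooth because \<open>f(t) = t\<^sup>2 G(t)\<close> with \<open>G\<close>
  smooth and even, so that \<open>G(|x|)\<close> is smooth on the disc: its differential is
  \<open>v \<mapsto> q(|x|) (x \<bullet> v)\<close> with \<open>q(t) = G'(t)/t\<close> again smooth and even.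
\<close>

section \<open>Functions of class C^k\<close>

text \<open>On an open set the derivative at a point depends only on nearby values in
  \<open>S\<close>, so agreement passes to all \<open>frechet_derivative\<close>s.\<close>

lemma Ck_on_cong:
  assumes "open S" "\<And>x. x \<in> S \<Longrightarrow> f x = g x" "Ck_on k S f"
  shows "Ck_on k S g"
  using assms(2,3)
proof (induction k arbitrary: f g)
  case 0
  then show ?case using continuous_on_cong[of S S f g] by simp
next
  case (Suc k)
  have D: "(g has_derivative frechet_derivative f (at x)) (at x)" if "x \<in> S" for x
    using Suc.prems that assms(1)
    by (intro has_derivative_transform_within_open[of f _ _ _ S g])
       (auto simp: frechet_derivative_works)
  then have eq: "frechet_derivative f (at x) v = frechet_derivative g (at x) v" if "x \<in> S" for x v
    using that by (metis frechet_derivative_at)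
  have "Ck_on k S (\<lambda>x. frechet_derivative g (at x) v)" for v
  proof (rule Suc.IH)
    show "Ck_on k S (\<lambda>x. frechet_derivative f (at x) v)"
      using Suc.prems(2) by simp
  qed (rule eq)
  with D show ?case by (auto simp: differentiable_def)
qed

text \<open>Uniqueness of derivatives lets an explicit family \<open>D\<close> stand in for
  \<open>frechet_derivative\<close>, so ordinary differentiation rules can drive the inductions
  below.\<close>

lemma Ck_on_SucI:
  assumes "open S" "\<And>x. x \<in> S \<Longrightarrow> (f has_derivative D x) (at x)"
    and "\<And>v. Ck_on k S (\<lambda>x. D x v)"
  shows "Ck_on (Suc k) S f"
proof -
  have "frechet_derivative f (at x) = D x" if "x \<in> S" for x
    using assms(2)[OF that] by (simp add: frechet_derivative_at[symmetric])
  then have "Ck_on k S (\<lambda>x. frechet_derivative f (at x) v)" for v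
    using assms(3)[of v] by (intro Ck_on_cong[OF assms(1) _ assms(3)[of v]]) auto
  with assms(2) show ?thesis by (auto simp: differentiable_def)
qed

lemma Ck_on_SucD: "Ck_on (Suc k) S f \<Longrightarrow> Ck_on k S f"
proof (induction k arbitrary: f)
  case 0
  then show ?case
    by (auto intro!: continuous_at_imp_continuous_on differentiable_imp_continuous_within)
next
  case (Suc k)
  have "\<forall>v. Ck_on (Suc k) S (\<lambda>x. frechet_derivative f (at x) v)"
    using Suc.prems Ck_on.simps(2)[of "Suc k" S f] by blast
  then have "\<forall>v. Ck_on k S (\<lambda>x. frechet_derivative f (at x) v)"
    using Suc.IH by blast
  moreover have "\<forall>x\<in>S. f differentiable (at x)"
    using Suc.prems by simp
  ultimately show ?case by simp
qed

lemma Ck_on_const: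
  assumes "open S"
  shows "Ck_on k S (\<lambda>x. c)"
  using assms
proof (induction k arbitrary: c)
  case (Suc k)
  then show ?case
    by (intro Ck_on_SucI[where D = "\<lambda>x v. 0"]) (auto intro!: derivative_eq_intros)
qed simp

lemma Ck_on_bounded_linear:
  assumes "open S" "bounded_linear f"
  shows "Ck_on k S f"
proof (cases k)
  case 0
  then show ?thesis using assms(2) by (simp add: linear_continuous_on)
next
  case (Suc l)
  show ?thesis
    unfolding Suc using assms
    by (intro Ck_on_SucI[where D = "\<lambda>x. f"] bounded_linear_imp_has_derivative Ck_on_const)
qed

lemma Ck_on_add:
  assumes "open S" "Ck_on k S f" "Ck_on k S g"
  shows "Ck_on k S (\<lambda>x. f x + g x)"
  using assms(2,3)
proof (induction k arbitrary: f g)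
  case 0
  then show ?case by (simp add: continuous_on_add)
next
  case (Suc k)
  show ?case
    using Suc.prems
    by (intro Ck_on_SucI[where D = "\<lambda>x v. frechet_derivative f (at x) v
            + frechet_derivative g (at x) v"] assms(1) Suc.IH has_derivative_add)
       (auto simp: frechet_derivative_works)
qed

lemma Ck_on_scaleR:
  fixes f :: "'a::real_normed_vector \<Rightarrow> real"
  assumes "open S" "Ck_on k S f" "Ck_on k S g"
  shows "Ck_on k S (\<lambda>x. f x *\<^sub>R g x)"
  using assms(2,3)
proof (induction k arbitrary: f g)
  case 0
  then show ?case by (simp add: continuous_on_scaleR)
next
  case (Suc k)
  \<comment> \<open>The product rule keeps \<open>f\<close> and \<open>g\<close> themselves as
    factors, so the induction hypothesis needs them at class \<open>k\<close> too.\<close>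
  note low = Suc.prems[THEN Ck_on_SucD]
  show ?case
    using Suc.prems
    by (intro Ck_on_SucI[where D = "\<lambda>x v. f x *\<^sub>R frechet_derivative g (at x) v
            + frechet_derivative f (at x) v *\<^sub>R g x"] assms(1) Ck_on_add Suc.IH low
          has_derivative_scaleR)
       (auto simp: frechet_derivative_works)
qed


section \<open>Radial functions\<close>


text \<open>Encodes smoothness of \<open>g 0\<close> up to the end points, with all one-sided
  derivatives carried along as data.\<close>

definition jet :: "real \<Rightarrow> (nat \<Rightarrow> real \<Rightarrow> real) \<Rightarrow> bool" where
  "jet L g \<longleftrightarrow> (\<forall>n. \<forall>t\<in>{0..L}. (g n has_real_derivative g (Suc n) t) (at t within {0..L}))"

lemma jet_continuous: "jet L g \<Longrightarrow> continuous_on {0..L} (g n)"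
  unfolding jet_def by (meson DERIV_continuous_on)

lemma jet_Suc: "jet L g \<Longrightarrow> jet L (\<lambda>n. g (Suc n))"
  by (simp add: jet_def)

lemma jet_MVT:
  assumes g: "jet L g" and ab: "0 \<le> a" "a < b" "b \<le> L"
  obtains t where "a < t" "t < b" "g n b - g n a = (b - a) * g (Suc n) t"
proof -
  have "continuous_on {a..b} (g n)"
    by (rule continuous_on_subset[OF jet_continuous[OF g]]) (use ab in auto)
  moreover have d: "(g n has_real_derivative g (Suc n) t) (at t)" if "a < t" "t < b" for t
  proof -
    have "(g n has_real_derivative g (Suc n) t) (at t within {0..L})"
      using g that ab by (simp add: jet_def)
    moreover have "at t within {0..L} = at t"
      using that ab by (intro at_within_interior) simp
    ultimately show ?thesis by simp
  qed
  ultimately obtain l t where t: "a < t" "t < b" "DERIV (g n) t :> l" "g n b - g n a = (b - a) * l"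
    using MVT[of a b "g n"] ab by (auto simp: real_differentiable_def)
  then have "l = g (Suc n) t" using d DERIV_unique by blast
  with t that show thesis by blast
qed

text \<open>The quotient is \<open>h(t)/t = \<integral> h'(s t) ds\<close> over \<open>0 \<le> s \<le> 1\<close>, differentiated under the
  integral sign.\<close>

lemma jet_divide:
  assumes h: "jet L h" and L: "0 < L" and h0: "h 0 0 = 0"
  obtains q where "jet L q" "\<And>t. t \<in> {0..L} \<Longrightarrow> h 0 t = t * q 0 t"
    "\<And>n. q n 0 = h (Suc n) 0 / Suc n"
proof
  \<comment> \<open>Each differentiation of h'(t s) in t brings out one factor s; hence
    \<open>s ^ n\<close> in the n-th derivative.\<close>
  define q where "q = (\<lambda>n t. integral (cbox 0 1) (\<lambda>s. s ^ n * h (Suc n) (t * s)))"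
  have mem: "t * s \<in> {0..L}" if "t \<in> {0..L}" "s \<in> {0..1}" for t s
    using that mult_left_le[of s t] by auto
  have cont: "continuous_on ({0..L} \<times> {0..1}) (\<lambda>(t, s). s ^ m * h n (t * s))" for m n
    using mem unfolding case_prod_unfold
    by (intro continuous_intros continuous_on_compose2[OF jet_continuous[OF h]]) auto
  have int: "(\<lambda>s. s ^ m * h n (t * s)) integrable_on cbox 0 1" if "t \<in> {0..L}" for t m n
    using that mem unfolding box_real
    by (intro integrable_continuous_real continuous_intros
          continuous_on_compose2[OF jet_continuous[OF h]]) auto
  have dh: "((\<lambda>t. h n (t * s)) has_real_derivative s * h (Suc n) (t * s)) (at t within {0..L})"
    if "t \<in> {0..L}" "s \<in> {0..1}" for t s n
  proof -
    have "(h n has_real_derivative h (Suc n) (t * s)) (at (t * s) within {0..L})"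
      using h mem[OF that] by (simp add: jet_def)
    moreover have "(\<lambda>t. t * s) ` {0..L} \<subseteq> {0..L}"
      using mem that(2) by blast
    ultimately have "(h n has_real_derivative h (Suc n) (t * s))
        (at (t * s) within (\<lambda>t. t * s) ` {0..L})"
      by (rule DERIV_subset)
    from DERIV_image_chain[OF this DERIV_cmult_Id[of s, unfolded mult.commute[of s]]]
    show ?thesis by (simp add: o_def mult.commute)
  qed
  show "jet L q"
    unfolding jet_def
  proof (intro allI ballI)
    fix n t assume t: "t \<in> {0..L}"
    show "(q n has_real_derivative q (Suc n) t) (at t within {0..L})"
      unfolding q_def
    proof (rule leibniz_rule_field_derivative[where U = "{0..L}"])
      fix t s :: real assume "t \<in> {0..L}" "s \<in> cbox 0 1"
      then show "((\<lambda>t. s ^ n * h (Suc n) (t * s)) has_real_derivative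
          s ^ Suc n * h (Suc (Suc n)) (t * s)) (at t within {0..L})"
        using DERIV_cmult[OF dh[of t s "Suc n"], of "s ^ n"] by (simp add: mult_ac)
    qed (use int t cont[of "Suc n" "Suc (Suc n)"] in simp_all)
  qed
  show "h 0 t = t * q 0 t" if t: "t \<in> {0..L}" for t
  proof -
    have "((\<lambda>s. t * h (Suc 0) (t * s)) has_integral h 0 (t * 1) - h 0 (t * 0)) {0..1}"
    proof (rule fundamental_theorem_of_calculus)
      fix s :: real assume s: "s \<in> {0..1}"
      have "(h 0 has_real_derivative h (Suc 0) (t * s)) (at (t * s) within {0..L})"
        using h mem[OF t s] by (simp add: jet_def)
      moreover have "(\<lambda>s. t * s) ` {0..1} \<subseteq> {0..L}"
        using mem[OF t] by blast
      ultimately have "(h 0 has_real_derivative h (Suc 0) (t * s))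
          (at (t * s) within (\<lambda>s. t * s) ` {0..1})"
        by (rule DERIV_subset)
      from DERIV_image_chain[OF this DERIV_cmult_Id]
      show "((\<lambda>s. h 0 (t * s)) has_vector_derivative t * h (Suc 0) (t * s)) (at s within {0..1})"
        by (simp add: o_def mult.commute flip: has_real_derivative_iff_has_vector_derivative)
    qed simp
    then show ?thesis
      by (simp add: q_def h0 integral_unique flip: integral_mult_right)
  qed
  \<comment> \<open>At t = 0 only the integral of \<open>s ^ n\<close> remains. These values carry
    the parity of the derivatives at 0 from \<open>h\<close> to \<open>q\<close>.\<close>
  show "q n 0 = h (Suc n) 0 / Suc n" for n
  proof -
    have "((\<lambda>s::real. s ^ n) has_integral 1 ^ Suc n / Suc n - 0 ^ Suc n / Suc n) {0..1}"
    proof (rule fundamental_theorem_of_calculus)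
      fix s :: real
      show "((\<lambda>s. s ^ Suc n / Suc n) has_vector_derivative s ^ n) (at s within {0..1})"
        using DERIV_cdivide[OF DERIV_pow[of "Suc n"], of "Suc n" s "{0..1}"]
        by (simp del: of_nat_Suc power_Suc flip: has_real_derivative_iff_has_vector_derivative)
    qed simp
    then have "integral {0..1} (\<lambda>s::real. s ^ n) = 1 / Suc n"
      by (simp add: integral_unique)
    then show ?thesis by (simp add: q_def)
  qed
qed


text \<open>Off the origin the chain rule gives g'(|x|) (x/|x|), and the factor |x| in g'(|x|)
  cancels the denominator. At the origin, where the norm is not differentiable, g(r) - g(0) = O(r^2)
  suffices.\<close>

lemma radial_has_derivative:
  fixes x :: "'a::real_inner"
  assumes g: "jet L g" and q: "continuous_on {0..L} q" "\<And>t. t \<in> {0..L} \<Longrightarrow> g 1 t = t * q t"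
    and x: "x \<in> ball 0 L"
  shows "((\<lambda>x. g 0 (norm x)) has_derivative (\<lambda>v. q (norm x) * (x \<bullet> v))) (at x)"
proof (cases "x = 0")
  case False
  have r: "norm x \<in> {0<..<L}" using x False by auto
  have "(g 0 has_real_derivative g 1 (norm x)) (at (norm x) within {0..L})"
    using g r by (auto simp: jet_def)
  moreover have "at (norm x) within {0..L} = at (norm x)"
    using r by (intro at_within_interior) auto
  ultimately have "(g 0 has_derivative (*) (g 1 (norm x))) (at (norm x))"
    by (simp add: has_field_derivative_def)
  from has_derivative_compose[OF has_derivative_norm[OF False] this]
  have "((\<lambda>x. g 0 (norm x)) has_derivative (\<lambda>v. g 1 (norm x) * (sgn x \<bullet> v))) (at x)"
    by (simp add: inner_commute)
  moreover have "g 1 (norm x) * (sgn x \<bullet> v) = q (norm x) * (x \<bullet> v)" for v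
    using q(2)[of "norm x"] r False by (simp add: sgn_div_norm)
  ultimately show ?thesis by simp
next
  case True
  have L: "0 < L" using x le_less_trans[OF norm_ge_zero, of x L] by simp
  obtain B where B: "\<And>t. t \<in> {0..L} \<Longrightarrow> \<bar>q t\<bar> \<le> B" and "B > 0"
    using compact_imp_bounded[OF compact_continuous_image[OF q(1)]]
    unfolding bounded_pos by fastforce
  \<comment> \<open>The mean value theorem gives r g'(t) with 0 < t < r, and |g'(t)| = t |q(t)| is
    at most r B.\<close>
  have bnd: "\<bar>g 0 r - g 0 0\<bar> \<le> B * r * r" if r: "r \<in> {0<..<L}" for r
  proof -
    obtain t where t: "0 < t" "t < r" "g 0 r - g 0 0 = (r - 0) * g 1 t"
      using jet_MVT[OF g, of 0 r 0] r by auto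
    have "\<bar>g 0 r - g 0 0\<bar> = r * (t * \<bar>q t\<bar>)"
      using t q(2)[of t] r by (simp add: abs_mult)
    also have "\<dots> \<le> r * (r * B)"
      using t r B[of t] by (intro mult_left_mono mult_mono) auto
    finally show ?thesis by (simp add: mult_ac)
  qed
  have "((\<lambda>y. g 0 (norm y)) has_derivative (\<lambda>v. 0)) (at (0::'a))"
    unfolding has_derivative_at
  proof (intro conjI bounded_linear_zero)
    show "(\<lambda>h::'a. norm (g 0 (norm (0 + h)) - g 0 (norm (0::'a)) - 0) / norm h) \<midarrow>0\<rightarrow> 0"
    proof (rule tendsto_sandwich[where f = "\<lambda>_. 0" and h = "\<lambda>h. B * norm h"])
      have "\<forall>\<^sub>F h::'a in at 0. norm h \<in> {0<..<L}"
        using L unfolding eventually_at by (intro exI[of _ L]) (auto simp: dist_norm)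
      then show "\<forall>\<^sub>F h::'a in at 0.
          norm (g 0 (norm (0 + h)) - g 0 (norm (0::'a)) - 0) / norm h \<le> B * norm h"
        by eventually_elim (use bnd in \<open>auto simp: pos_divide_le_eq\<close>)
      show "(\<lambda>h::'a. B * norm h) \<midarrow>0\<rightarrow> 0"
        by (auto intro!: tendsto_eq_intros)
    qed auto
  qed
  then show ?thesis using True by simp
qed

text \<open>Induction over all such \<open>g\<close>: the derivative is \<open>q 0 (norm x)\<close>
  times a linear function, and \<open>q n 0\<close> is a multiple of \<open>g (n + 2) 0\<close>, so
  \<open>q\<close> again has vanishing odd derivatives at 0.\<close>

lemma radial_Ck_on:
  fixes L :: real
  assumes "jet L g" "0 < L" "\<And>n. odd n \<Longrightarrow> g n 0 = 0"
  shows "Ck_on k (ball (0::'a::real_inner) L) (\<lambda>x. g 0 (norm x))"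
  using assms(1,3)
proof (induction k arbitrary: g)
  case 0
  then show ?case
    by (auto intro!: continuous_intros continuous_on_compose2[OF jet_continuous[OF 0(1)]])
next
  case (Suc k)
  obtain q where q: "jet L q" "\<And>t. t \<in> {0..L} \<Longrightarrow> g 1 t = t * q 0 t"
      "\<And>n. q n 0 = g (Suc (Suc n)) 0 / Suc n"
    using jet_divide[OF jet_Suc[OF Suc.prems(1)] assms(2)] Suc.prems(2)[of 1] by auto
  have "Ck_on k (ball (0::'a) L) (\<lambda>x. q 0 (norm x) *\<^sub>R (x \<bullet> v))" for v
    using q Suc.prems(2)
    by (intro Ck_on_scaleR Suc.IH Ck_on_bounded_linear) (auto intro: bounded_linear_inner_left)
  then show ?case
    by (intro Ck_on_SucI[where D = "\<lambda>x v. q 0 (norm x) * (x \<bullet> v)"]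
          radial_has_derivative[OF Suc.prems(1) jet_continuous[OF q(1)] q(2)]) auto
qed

section \<open>The rotationally invariant primitive\<close>

locale symmetric_profile =
  fixes L :: real and \<gamma> :: "real \<Rightarrow> real"
  assumes profile: "normalized_profile L \<gamma>"
    and symm: "\<And>t. t \<in> {0..L} \<Longrightarrow> \<gamma> t = \<gamma> (L - t)"
    and mono: "mono_on {0..L/2} (gauss_curvature L \<gamma>)"
begin

abbreviation K :: "real \<Rightarrow> real" where "K \<equiv> gauss_curvature L \<gamma>"

abbreviation D :: "nat \<Rightarrow> real \<Rightarrow> real" where "D \<equiv> deriv_iter L \<gamma>"

text \<open>\<open>f n\<close> is the \<open>n\<close>-th derivative of the coefficient of the primitive \<open>f 0 d\<theta>\<close>.\<close>

fun f :: "nat \<Rightarrow> real \<Rightarrow> real" where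
  "f 0 t = integral {0..t} \<gamma> + D 1 t - 1"
| "f (Suc n) t = D n t + D (Suc (Suc n)) t"

lemma L_pos: "0 < L"
  using profile by (simp add: normalized_profile_def)

lemma \<gamma>_pos: "t \<in> {0<..<L} \<Longrightarrow> 0 < \<gamma> t"
  using profile by (simp add: normalized_profile_def)

lemma jet_D: "jet L D"
  unfolding jet_def
proof (intro allI ballI)
  fix n t assume "t \<in> {0..L}"
  then have "D n differentiable (at t within {0..L})"
    using profile by (simp add: normalized_profile_def smooth_on_interval_def differentiable_on_def)
  then show "(D n has_real_derivative D (Suc n) t) (at t within {0..L})"
    by (simp add: vector_derivative_works has_real_derivative_iff_has_vector_derivative)
qed

lemma deriv_unique:
  assumes "t \<in> {0..L}" "(h has_real_derivative a) (at t within {0..L})"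
    "(h has_real_derivative b) (at t within {0..L})"
  shows "a = b"
  using assms L_pos vector_derivative_unique_within_closed_interval[of 0 L t h a b]
  by (simp add: has_real_derivative_iff_has_vector_derivative)

lemma reflect_derivative:
  assumes "jet L h" "t \<in> {0..L}"
  shows "((\<lambda>t. h n (L - t)) has_real_derivative - h (Suc n) (L - t)) (at t within {0..L})"
proof -
  have "(h n has_real_derivative h (Suc n) (L - t)) (at (L - t) within {0..L})"
    using assms by (auto simp: jet_def)
  then have "(h n has_real_derivative h (Suc n) (L - t)) (at (L - t) within (\<lambda>t. L - t) ` {0..L})"
    by (rule DERIV_subset) auto
  moreover have "((\<lambda>t. L - t) has_real_derivative - 1) (at t within {0..L})"
    by (auto intro!: derivative_eq_intros)
  ultimately have "(h n \<circ> (\<lambda>t. L - t) has_real_derivative h (Suc n) (L - t) * - 1) (at t within {0..L})"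
    by (rule DERIV_image_chain)
  then show ?thesis by (simp add: o_def)
qed

text \<open>Each differentiation of the reflection identity contributes a sign. For odd
  \<open>n\<close> the derivative therefore vanishes at L/2.\<close>

lemma D_symm: "t \<in> {0..L} \<Longrightarrow> D n (L - t) = (- 1) ^ n * D n t"
proof (induction n arbitrary: t)
  case 0
  then show ?case using symm[of t] by simp
next
  case (Suc n)
  have "((\<lambda>t. (- 1) ^ n * D n t) has_real_derivative - D (Suc n) (L - t)) (at t within {0..L})"
    by (rule has_field_derivative_transform_within[OF reflect_derivative[OF jet_D Suc.prems, of n]
          zero_less_one Suc.prems Suc.IH])
  moreover have "((\<lambda>t. (- 1) ^ n * D n t) has_real_derivative (- 1) ^ n * D (Suc n) t)
      (at t within {0..L})"
    using jet_D Suc.prems by (intro DERIV_cmult) (simp add: jet_def)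
  ultimately have "- D (Suc n) (L - t) = (- 1) ^ n * D (Suc n) t"
    by (rule deriv_unique[OF Suc.prems])
  then show ?case by simp
qed

lemma jet_f: "jet L f"
  unfolding jet_def
proof (intro allI ballI)
  fix n t assume t: "t \<in> {0..L}"
  have D: "(D n has_real_derivative D (Suc n) t) (at t within {0..L})" for n
    using jet_D t by (simp add: jet_def)
  have "((\<lambda>t. integral {0..t} \<gamma>) has_real_derivative \<gamma> t) (at t within {0..L})"
    using jet_continuous[OF jet_D, of 0] t by (intro integral_has_real_derivative) auto
  then show "(f n has_real_derivative f (Suc n) t) (at t within {0..L})"
  proof (cases n)
    case 0
    have "f n = (\<lambda>t. integral {0..t} \<gamma> + D 1 t - 1)"
      by (simp add: fun_eq_iff 0)
    then show ?thesis
      using DERIV_diff[OF DERIV_add[OF \<open>((\<lambda>t. integral {0..t} \<gamma>) has_real_derivative \<gamma> t) _\<close> D[of 1]]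
          DERIV_const[of 1]] 0
      by simp
  next
    case (Suc m)
    have "f n = (\<lambda>t. D m t + D (Suc (Suc m)) t)"
      by (simp add: fun_eq_iff Suc del: deriv_iter.simps)
    then show ?thesis
      using DERIV_add[OF D[of m] D[of "Suc (Suc m)"]] Suc by simp
  qed
qed

lemma f_0: "f 0 0 = 0"
  using profile by (simp add: normalized_profile_def)

text \<open>An odd derivative of f is a sum of two even derivatives of \<gamma>, which vanish at the
  pole.\<close>

lemma f_odd_0: "odd n \<Longrightarrow> f n 0 = 0"
proof (erule oddE)
  fix k assume k: "n = 2 * k + 1"
  have "D (2 * k) 0 = 0" "D (2 * Suc k) 0 = 0"
    using profile unfolding normalized_profile_def by blast+
  then show ?thesis by (simp add: k del: deriv_iter.simps)
qed

text \<open>Since f' = \<gamma> + \<gamma>'' is even about L/2, f(t) + f(L - t) is constant. Its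
  value at t = 0 is f(L) = 2 - 1 - 1 = 0, where the total integral 2 enters.\<close>

lemma f_symm:
  assumes "t \<in> {0..L}"
  shows "f 0 (L - t) = - f 0 t"
proof -
  have "\<exists>c. \<forall>t\<in>{0..L}. f 0 t + f 0 (L - t) = c"
  proof (rule has_field_derivative_zero_constant)
    fix t assume t: "t \<in> {0..L}"
    have "f (Suc 0) (L - t) = f (Suc 0) t"
      using D_symm[OF t, of 0] D_symm[OF t, of 2] by (simp add: eval_nat_numeral del: deriv_iter.simps)
    moreover have "(f 0 has_real_derivative f (Suc 0) t) (at t within {0..L})"
      using jet_f t unfolding jet_def by blast
    ultimately show "((\<lambda>t. f 0 t + f 0 (L - t)) has_real_derivative 0) (at t within {0..L})"
      using DERIV_add[OF _ reflect_derivative[OF jet_f t, of 0], of "f 0" "f (Suc 0) t"] by simp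
  qed simp
  then obtain c where "\<And>t. t \<in> {0..L} \<Longrightarrow> f 0 t + f 0 (L - t) = c" by blast
  note c = this[OF assms] this[of 0]
  have "f 0 L = 0"
    using profile by (simp add: normalized_profile_def)
  with c f_0 L_pos show ?thesis by simp
qed

lemma f_half: "f 0 (L / 2) = 0"
  using f_symm[of "L / 2"] L_pos by (simp del: f.simps)

section \<open>Curvature and the bound |f| \<le> \<gamma>\<close>

lemma K_\<gamma>: "t \<in> {0<..<L} \<Longrightarrow> K t * \<gamma> t = - D 2 t"
  using \<gamma>_pos[of t] by (simp add: gauss_curvature_def Let_def)

lemma f_1: "t \<in> {0<..<L} \<Longrightarrow> f 1 t = (1 - K t) * \<gamma> t"
  using K_\<gamma>[of t] by (simp add: left_diff_distrib numeral_2_eq_2 del: deriv_iter.simps(2))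

lemma K_symm:
  assumes "t \<in> {0<..<L}"
  shows "K (L - t) = K t"
  using D_symm[of t 2] symm[of t] assms by (simp add: gauss_curvature_def Let_def)

lemma K_mono: "0 < s \<Longrightarrow> s \<le> t \<Longrightarrow> t \<le> L / 2 \<Longrightarrow> K s \<le> K t"
  by (rule mono_onD[OF mono]) auto

text \<open>Otherwise the curvature would be negative near the pole, making \<open>\<gamma>'\<close> exceed \<open>1\<close>.\<close>

lemma concave:
  assumes t: "0 < t" "t \<le> L / 2"
  shows "D 2 t \<le> 0"
proof (rule ccontr)
  assume "\<not> D 2 t \<le> 0"
  then have "K t * \<gamma> t < 0"
    using K_\<gamma>[of t] t L_pos by simp
  then have Kt: "K t < 0"
    using \<gamma>_pos[of t] t L_pos by (simp add: mult_less_0_iff)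
  obtain s where s: "0 < s" "s < t" "D 1 t - D 1 0 = (t - 0) * D (Suc 1) s"
    using jet_MVT[OF jet_D, of 0 t 1] t L_pos by auto
  \<comment> \<open>Monotonicity carries the negative sign of \<open>K\<close> from \<open>t\<close>
    back to the earlier point \<open>s\<close>.\<close>
  have "K s * \<gamma> s < 0"
    using K_mono[of s t] Kt s t \<gamma>_pos[of s] L_pos by (simp add: mult_less_0_iff)
  then have "0 < D (Suc 1) s"
    using K_\<gamma>[of s] s t L_pos by (simp add: numeral_2_eq_2 del: deriv_iter.simps)
  then have "0 < (t - 0) * D (Suc 1) s"
    using t by simp
  moreover have "D 1 0 = 1"
    using profile by (simp add: normalized_profile_def)
  ultimately have "D 1 t > 1"
    using s(3) by linarith
  moreover have "\<bar>D 1 t\<bar> < 1"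
    using profile t L_pos unfolding normalized_profile_def by simp
  ultimately show False by simp
qed

lemma D_1_antimono:
  assumes "0 < s" "s \<le> t" "t \<le> L / 2"
  shows "D 1 t \<le> D 1 s"
proof (cases "s = t")
  case False
  then obtain r where r: "s < r" "r < t" "D 1 t - D 1 s = (t - s) * D (Suc 1) r"
    using jet_MVT[OF jet_D, of s t 1] assms L_pos by auto
  have "D (Suc 1) r \<le> 0"
    using concave[of r] r assms by (simp add: numeral_2_eq_2 del: deriv_iter.simps)
  then have "(t - s) * D (Suc 1) r \<le> 0"
    using assms by (intro mult_nonneg_nonpos) auto
  with r show ?thesis by simp
qed simp

text \<open>By symmetry \<gamma>' vanishes at L/2, and it decreases towards that point, so it is
  nonnegative before.\<close>

lemma \<gamma>_mono:
  assumes "0 < s" "s \<le> t" "t \<le> L / 2"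
  shows "\<gamma> s \<le> \<gamma> t"
proof (cases "s = t")
  case False
  then obtain r where r: "s < r" "r < t" "D 0 t - D 0 s = (t - s) * D (Suc 0) r"
    using jet_MVT[OF jet_D, of s t 0] assms L_pos by auto
  have "D 1 (L / 2) = 0"
    using D_symm[of "L / 2" 1] L_pos by (simp del: deriv_iter.simps)
  then have "0 \<le> D (Suc 0) r"
    using D_1_antimono[of r "L / 2"] r assms by (simp del: deriv_iter.simps)
  then have "0 \<le> (t - s) * D (Suc 0) r"
    using assms by (intro mult_nonneg_nonneg) auto
  with r show ?thesis by simp
qed simp

text \<open>As \<gamma> \<ge> 0, the integral is largest at L/2, where f = 0 and \<gamma>' = 0 force
  it to equal 1.\<close>

lemma integral_le_1:
  assumes "0 < t" "t \<le> L / 2"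
  shows "integral {0..t} \<gamma> \<le> 1"
proof -
  have int: "\<gamma> integrable_on {0..s}" if "s \<le> L / 2" for s
    using jet_continuous[OF jet_D, of 0] that L_pos
    by (intro integrable_continuous_real) (auto intro: continuous_on_subset)
  have "integral {0..t} \<gamma> \<le> integral {0..L / 2} \<gamma>"
  proof (intro integral_subset_le ballI)
    fix s assume "s \<in> {0..L / 2}"
    then have "s = 0 \<or> s \<in> {0<..<L}"
      using L_pos by auto
    moreover have "\<gamma> 0 = 0"
      using profile by (simp add: normalized_profile_def)
    ultimately show "0 \<le> \<gamma> s"
      using \<gamma>_pos[of s] by auto
  qed (use assms int in auto)
  moreover have "D 1 (L / 2) = 0"
    using D_symm[of "L / 2" 1] L_pos by (simp del: deriv_iter.simps)
  ultimately show ?thesis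
    using f_half by (simp del: deriv_iter.simps)
qed

lemma f_le_\<gamma>:
  assumes t: "0 < t" "t \<le> L / 2"
  shows "f 0 t \<le> \<gamma> t"
proof (cases "D 1 t \<le> \<gamma> t")
  case True
  then show ?thesis using integral_le_1[OF t] by (simp del: deriv_iter.simps)
next
  case False
  \<comment> \<open>The mean value theorem is applied to \<gamma> - f, which vanishes at 0.\<close>
  have "jet L (\<lambda>n t. D n t - f n t)"
    using jet_D jet_f unfolding jet_def by (intro allI ballI DERIV_diff) auto
  then obtain s where s: "0 < s" "s < t"
      "D 0 t - f 0 t - (D 0 0 - f 0 0) = (t - 0) * (D (Suc 0) s - f (Suc 0) s)"
    using jet_MVT[of L "\<lambda>n t. D n t - f n t" 0 t 0] t L_pos by auto
  \<comment> \<open>The chain is f'(s) = \<gamma>(s) + \<gamma>''(s) \<le> \<gamma>(s) \<le>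
    \<gamma>(t) < \<gamma>'(t) \<le> \<gamma>'(s).\<close>
  have "f (Suc 0) s \<le> \<gamma> s"
    using concave[of s] s t by (simp add: numeral_2_eq_2 del: deriv_iter.simps(2))
  also have "\<dots> \<le> \<gamma> t"
    using \<gamma>_mono s t by simp
  also have "\<dots> \<le> D (Suc 0) s"
    using False D_1_antimono[of s t] s t by (simp del: deriv_iter.simps)
  finally have "0 \<le> (t - 0) * (D (Suc 0) s - f (Suc 0) s)"
    using t by simp
  moreover have "D 0 0 = 0"
    using profile by (simp add: normalized_profile_def)
  ultimately have "0 \<le> D 0 t - f 0 t" using s(3) f_0 by linarith
  then show ?thesis by simp
qed

text \<open>By monotonicity of \<open>K\<close>, once \<open>f\<close> decreases it does so up to \<open>L/2\<close>, where it vanishes.\<close>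

lemma f_nonneg:
  assumes t: "0 < t" "t \<le> L / 2"
  shows "0 \<le> f 0 t"
proof (rule ccontr)
  assume neg: "\<not> 0 \<le> f 0 t"
  then have "t < L / 2" using f_half t by (cases "t = L / 2") auto
  obtain s where s: "0 < s" "s < t" "f 0 t - f 0 0 = (t - 0) * f (Suc 0) s"
    using jet_MVT[OF jet_f, of 0 t 0] t L_pos by (auto simp del: f.simps)
  obtain r where r: "t < r" "r < L / 2" "f 0 (L / 2) - f 0 t = (L / 2 - t) * f (Suc 0) r"
    using jet_MVT[OF jet_f, of t "L / 2" 0] t \<open>t < L / 2\<close> L_pos by (auto simp del: f.simps)
  \<comment> \<open>A negative value between two zeros makes f fall before \<open>t\<close> and rise
    after it. Since f' = (1 - K) \<gamma>, \<open>K\<close> would drop from above 1 at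
    \<open>s\<close> to below 1 at \<open>r\<close>.\<close>
  have "t * f 1 s < 0" "0 < (L / 2 - t) * f 1 r"
    using s(3) r(3) neg f_0 f_half by (simp_all del: f.simps)
  then have "f 1 s < 0" "0 < f 1 r"
    using t \<open>t < L / 2\<close> by (simp_all add: mult_less_0_iff zero_less_mult_iff del: f.simps)
  then have "(1 - K s) * \<gamma> s < 0" "0 < (1 - K r) * \<gamma> r"
    using f_1[of s] f_1[of r] s r t by (simp_all del: f.simps)
  then have "K s > 1" "K r < 1"
    using \<gamma>_pos[of s] \<gamma>_pos[of r] s r t by (simp_all add: mult_less_0_iff zero_less_mult_iff)
  then show False using K_mono[of s r] s r t by simp
qed

lemma abs_f_le:
  assumes t: "t \<in> {0<..<L}"
  shows "\<bar>f 0 t\<bar> \<le> \<gamma> t"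
proof (cases "t \<le> L / 2")
  case True
  then show ?thesis using f_le_\<gamma>[of t] f_nonneg[of t] t by simp
next
  case False
  then show ?thesis
    using f_le_\<gamma>[of "L - t"] f_nonneg[of "L - t"] f_symm[of t] symm[of t] t by simp
qed

end

section \<open>Plane forms and the change of charts\<close>

text \<open>This is r^2 d\<theta>, which unlike d\<theta> is linear in the base point and so smooth
  at the pole.\<close>

definition det_form :: "plane \<Rightarrow> plane \<Rightarrow>\<^sub>L real" where
  "det_form x = fst x *\<^sub>R Blinfun snd - snd x *\<^sub>R Blinfun fst"

lemma det_form_apply [simp]: "det_form x v = det2 x v"
  by (simp add: det_form_def det2_def blinfun.diff_left blinfun.scaleR_left
      bounded_linear_Blinfun_apply bounded_linear_fst bounded_linear_snd)

lemma bounded_linear_det_form: "bounded_linear det_form"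
  unfolding det_form_def
  by (intro bounded_linear_sub bounded_linear_compose[OF bounded_linear_scaleR_left]
        bounded_linear_fst bounded_linear_snd)

text \<open>Turns wedge products of radial and angular forms into multiples of the Euclidean area
  form; needed for both d\<beta> and \<open>area_form\<close>.\<close>

lemma det2_cyclic:
  "(x \<bullet> v) * det2 x w - (x \<bullet> w) * det2 x v = (norm x)\<^sup>2 * det2 v w"
  unfolding power2_norm_eq_inner by (cases x; cases v; cases w) (simp add: det2_def algebra_simps)

lemma det2_scaleR_shear: "det2 (a *\<^sub>R x) (a *\<^sub>R v + c *\<^sub>R x) = a\<^sup>2 * det2 x v"
  by (simp add: det2_def power2_eq_square algebra_simps)

lemma norm_transition:
  assumes "x \<noteq> 0" "norm x < L"
  shows "norm (transition L x) = L - norm x"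
  using assms by (simp add: transition_def)

text \<open>The radial coefficient \<open>c\<close> may stay unknown, since
  \<open>det2_scaleR_shear\<close> discards it.\<close>

lemma transition_derivative:
  assumes "x \<noteq> 0"
  obtains c where "frechet_derivative (transition L) (at x) v
    = ((L - norm x) / norm x) *\<^sub>R v + c *\<^sub>R x"
proof -
  have "(\<lambda>x::plane. (L - norm x) / norm x) differentiable (at x)"
    using assms by (intro differentiable_divide differentiable_diff differentiable_const
        differentiable_norm_at) auto
  then obtain A where A: "((\<lambda>x::plane. (L - norm x) / norm x) has_derivative A) (at x)"
    by (auto simp: differentiable_def)
  have "(transition L has_derivative (\<lambda>v. ((L - norm x) / norm x) *\<^sub>R v + A v *\<^sub>R x)) (at x)"
    unfolding transition_def using has_derivative_scaleR[OF A has_derivative_ident] .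
  from frechet_derivative_at[OF this] show thesis
    using that[of "A v"] by metis
qed

lemma at_within_pole_not_bot:
  fixes L :: real
  assumes "0 < L"
  shows "at 0 within {0<..<L} \<noteq> bot" "at L within {0<..<L} \<noteq> bot"
  using assms by (auto simp: trivial_limit_within islimpt_greaterThanLessThan1
      islimpt_greaterThanLessThan2)

section \<open>Regularity at the poles and construction of the form\<close>

context symmetric_profile
begin

text \<open>Both f and f' vanish at 0, so f can be divided by t twice. Up to a factor,
  \<open>G n 0\<close> is \<open>f (n + 2) 0\<close>, so parity survives.\<close>

lemma primitive_radial_coefficient:
  obtains G where "jet L G" "\<And>n. odd n \<Longrightarrow> G n 0 = 0"
    "\<And>t. t \<in> {0..L} \<Longrightarrow> f 0 t = t\<^sup>2 * G 0 t"
    "\<And>t. t \<in> {0..L} \<Longrightarrow> f 1 t = t * (2 * G 0 t + t * G 1 t)"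
proof -
  obtain p where p: "jet L p" "\<And>t. t \<in> {0..L} \<Longrightarrow> f 0 t = t * p 0 t"
      "\<And>n. p n 0 = f (Suc n) 0 / Suc n"
    using jet_divide[OF jet_f L_pos f_0] by blast
  have "p 0 0 = 0"
    using p(3)[of 0] f_odd_0[of 1] by simp
  then obtain G where G: "jet L G" "\<And>t. t \<in> {0..L} \<Longrightarrow> p 0 t = t * G 0 t"
      "\<And>n. G n 0 = p (Suc n) 0 / Suc n"
    using jet_divide[OF p(1) L_pos] by blast
  have eq: "f 0 t = t\<^sup>2 * G 0 t" if "t \<in> {0..L}" for t
    using p(2)[OF that] G(2)[OF that] by (simp add: power2_eq_square del: f.simps)
  have "f 1 t = t * (2 * G 0 t + t * G 1 t)" if t: "t \<in> {0..L}" for t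
  proof (rule deriv_unique[OF t])
    show "(f 0 has_real_derivative f 1 t) (at t within {0..L})"
      using jet_f t unfolding jet_def One_nat_def by blast
    have "(G 0 has_real_derivative G 1 t) (at t within {0..L})"
      using G(1) t by (simp add: jet_def)
    then have "((\<lambda>t. t\<^sup>2 * G 0 t) has_real_derivative t * (2 * G 0 t + t * G 1 t))
        (at t within {0..L})"
      by (auto intro!: derivative_eq_intros simp: algebra_simps power2_eq_square)
    then show "(f 0 has_real_derivative t * (2 * G 0 t + t * G 1 t)) (at t within {0..L})"
      by (rule has_field_derivative_transform_within[OF _ zero_less_one t]) (simp add: eq del: f.simps)
  qed
  moreover have "G n 0 = 0" if "odd n" for n
    using G(3) p(3) f_odd_0[of "Suc (Suc n)"] that by (simp del: f.simps)
  ultimately show thesis using that[OF G(1)] eq by blast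
qed

text \<open>Dividing f' = (1 - K) \<gamma> by t gives 1 - K = (2 G + t G') / (\<gamma>/t), and
  \<gamma>/t tends to \<gamma>'(0) = 1. Reflection carries the limit to the other pole.\<close>

lemma K_pole:
  assumes G: "jet L G"
    and f1: "\<And>t. t \<in> {0..L} \<Longrightarrow> f 1 t = t * (2 * G 0 t + t * G 1 t)"
  shows "K 0 = 1 - 2 * G 0 0" "K L = 1 - 2 * G 0 0"
proof -
  let ?K = "\<lambda>s. - D 2 s / \<gamma> s"
  have slope: "((\<lambda>t. \<gamma> t / t) \<longlongrightarrow> 1) (at 0 within {0<..<L})"
  proof -
    have "\<gamma> 0 = 0" "D 1 0 = 1"
      using profile by (simp_all add: normalized_profile_def)
    moreover have "(D 0 has_real_derivative D (Suc 0) 0) (at 0 within {0..L})"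
      using jet_D L_pos unfolding jet_def by (meson atLeastAtMost_iff less_imp_le order_refl)
    ultimately have "((\<lambda>t. \<gamma> t / t) \<longlongrightarrow> 1) (at 0 within {0..L})"
      by (simp add: has_field_derivative_iff)
    then show ?thesis by (rule tendsto_within_subset) auto
  qed
  have cont: "(G n \<longlongrightarrow> G n 0) (at 0 within {0<..<L})" for n
    using jet_continuous[OF G, of n] L_pos
    by (auto simp: continuous_on_def intro: tendsto_within_subset[where S = "{0..L}"])
  have lim: "((\<lambda>t. 1 - (2 * G 0 t + t * G 1 t) / (\<gamma> t / t)) \<longlongrightarrow> 1 - (2 * G 0 0 + 0 * G 1 0) / 1)
      (at 0 within {0<..<L})"
    by (intro tendsto_intros cont slope) simp
  have "1 - (2 * G 0 t + t * G 1 t) / (\<gamma> t / t) = ?K t" if t: "t \<in> {0<..<L}" for t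
  proof -
    have "t * (2 * G 0 t + t * G 1 t) = \<gamma> t + D 2 t"
      using f1[of t] t by (simp add: numeral_2_eq_2 del: deriv_iter.simps(2))
    then have "1 - (2 * G 0 t + t * G 1 t) / (\<gamma> t / t) = 1 - (\<gamma> t + D 2 t) / \<gamma> t"
      by (simp add: mult.commute)
    then show ?thesis
      using \<gamma>_pos[OF t] by (simp add: add_divide_distrib)
  qed
  from Lim_transform_within[OF lim zero_less_one this]
  have lim0: "(?K \<longlongrightarrow> 1 - 2 * G 0 0) (at 0 within {0<..<L})"
    by simp
  show "K 0 = 1 - 2 * G 0 0"
    using tendsto_Lim[OF at_within_pole_not_bot(1)[OF L_pos] lim0]
    by (simp add: gauss_curvature_def Let_def del: deriv_iter.simps)
  have "filterlim (\<lambda>t. L - t) (at 0 within {0<..<L}) (at L within {0<..<L})"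
    unfolding filterlim_at eventually_at_filter by (auto intro!: tendsto_eq_intros)
  from filterlim_compose[OF lim0 this]
  have lim: "((\<lambda>t. ?K (L - t)) \<longlongrightarrow> 1 - 2 * G 0 0) (at L within {0<..<L})" .
  have "?K (L - t) = ?K t" if "t \<in> {0<..<L}" for t
    using D_symm[of t 2] symm[of t] that by (simp del: deriv_iter.simps)
  from Lim_transform_within[OF lim zero_less_one this]
  show "K L = 1 - 2 * G 0 0"
    using tendsto_Lim[OF at_within_pole_not_bot(2)[OF L_pos]]
    by (simp add: gauss_curvature_def Let_def del: deriv_iter.simps)
qed

lemma exists_primitive:
  obtains \<beta> where "\<beta> \<in> primitives L \<gamma>" "\<And>p x. x \<in> ball 0 L \<Longrightarrow> dual_norm L \<gamma> \<beta> p x \<le> 1"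
proof -
  obtain G where G: "jet L G" and odd: "\<And>n. odd n \<Longrightarrow> G n 0 = 0"
    and fG: "\<And>t. t \<in> {0..L} \<Longrightarrow> f 0 t = t\<^sup>2 * G 0 t"
    and f1: "\<And>t. t \<in> {0..L} \<Longrightarrow> f 1 t = t * (2 * G 0 t + t * G 1 t)"
    using primitive_radial_coefficient by blast
  obtain q where q: "jet L q" "\<And>t. t \<in> {0..L} \<Longrightarrow> G 1 t = t * q 0 t"
    using jet_divide[OF jet_Suc[OF G] L_pos, unfolded One_nat_def[symmetric]] odd[of 1]
    by (metis odd_one)
  \<comment> \<open>This is f d\<theta> in both charts: in \<open>South\<close> t = L - r, and f(L -
    r) = - f(r) accounts for the sign \<open>orient p\<close>.\<close>
  define \<beta> :: form1 where "\<beta> = (\<lambda>p x. G 0 (norm x) *\<^sub>R orient p *\<^sub>R det_form x)"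
  have \<beta>: "\<beta> p x v = G 0 (norm x) * orient p * det2 x v" for p x v
    by (simp add: \<beta>_def blinfun.scaleR_left)
  have "smooth_on (ball 0 L) (\<beta> p)" for p
    unfolding smooth_on_def \<beta>_def
    by (intro allI Ck_on_scaleR Ck_on_bounded_linear radial_Ck_on[OF G L_pos odd]
          bounded_linear_compose[OF bounded_linear_scaleR_right] bounded_linear_det_form open_ball)
  moreover have "\<beta> North x v = \<beta> South (transition L x) (frechet_derivative (transition L) (at x) v)"
    if "x \<in> ball 0 L - {0}" for x v
  proof -
    define r where "r = norm x"
    have r: "0 < r" "r < L" using that by (auto simp: r_def)
    obtain c where c: "frechet_derivative (transition L) (at x) v = ((L - r) / r) *\<^sub>R v + c *\<^sub>R x"
      unfolding r_def by (rule transition_derivative) (use r in \<open>auto simp: r_def\<close>)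
    have "\<beta> South (transition L x) (frechet_derivative (transition L) (at x) v)
        = - G 0 (L - r) * ((L - r) / r)\<^sup>2 * det2 x v"
      using that by (simp add: \<beta> c norm_transition orient_def flip: r_def)
        (simp add: transition_def det2_scaleR_shear flip: r_def)
    \<comment> \<open>Compatibility of the two charts thus reduces to the oddness of f about
      L/2.\<close>
    also have "\<dots> = - f 0 (L - r) / r\<^sup>2 * det2 x v"
      using fG[of "L - r"] r by (simp add: power_divide del: f.simps)
    also have "\<dots> = G 0 r * det2 x v"
      using fG[of r] f_symm[of r] r by (simp del: f.simps)
    finally show ?thesis
      by (simp add: \<beta> orient_def r_def)
  qed
  ultimately have "one_form L \<beta>"
    unfolding one_form_def by blast
  moreover have "ext_deriv \<beta> p x v w
      = (1 - K (coord_t L p x)) * area_form L \<gamma> p x v w" if x: "x \<in> ball 0 L" for p x v w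
  proof -
    define r where "r = norm x"
    have r: "0 \<le> r" "r < L" using x by (auto simp: r_def)
    have "(\<beta> p has_derivative (\<lambda>v. G 0 r *\<^sub>R orient p *\<^sub>R det_form v
        + (q 0 r * (x \<bullet> v)) *\<^sub>R orient p *\<^sub>R det_form x)) (at x)"
      unfolding \<beta>_def r_def
      by (intro has_derivative_scaleR radial_has_derivative[OF G jet_continuous[OF q(1)] q(2)]
            bounded_linear_imp_has_derivative x
            bounded_linear_compose[OF bounded_linear_scaleR_right] bounded_linear_det_form)
    note d = frechet_derivative_at[OF this, symmetric]
    \<comment> \<open>The linear form contributes 2 G and the radial coefficient r^2 q = r G',
      matching f'/r.\<close>
    have "ext_deriv \<beta> p x v w = orient p * (G 0 r * (det2 v w - det2 w v)
        + q 0 r * ((x \<bullet> v) * det2 x w - (x \<bullet> w) * det2 x v))"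
      by (simp add: ext_deriv_def d blinfun.add_left blinfun.scaleR_left algebra_simps)
    also have "\<dots> = orient p * ((2 * G 0 r + r * (r * q 0 r)) * det2 v w)"
      unfolding det2_cyclic r_def[symmetric] by (simp add: det2_def power2_eq_square algebra_simps)
    also have "r * q 0 r = G 1 r"
      using q(2)[of r] r by simp
    finally have ext: "ext_deriv \<beta> p x v w = orient p * ((2 * G 0 r + r * G 1 r) * det2 v w)" .
    show ?thesis
    proof (cases "x = 0")
      case True
      then show ?thesis
        unfolding ext using K_pole[OF G f1]
        by (cases p) (simp_all add: r_def coord_t_def area_form_def)
    next
      case False
      then have r': "r \<in> {0<..<L}" using r by (auto simp: r_def)
      have "K (coord_t L p x) = K r" "\<gamma> (coord_t L p x) = \<gamma> r"
        using K_symm[OF r'] symm[of r] r' by (cases p; simp add: coord_t_def flip: r_def)+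
      moreover have "area_form L \<gamma> p x v w = \<gamma> (coord_t L p x) * (orient p * det2 v w / r)"
      proof -
        have "form_dt p x v * form_dtheta x w - form_dt p x w * form_dtheta x v
            = orient p * ((x \<bullet> v) * det2 x w - (x \<bullet> w) * det2 x v) / (r * r\<^sup>2)"
          by (simp add: form_dt_def form_dtheta_def r_def right_diff_distrib diff_divide_distrib)
        also have "\<dots> = orient p * det2 v w / r"
          unfolding det2_cyclic r_def[symmetric] using r' by simp
        finally show ?thesis using False by (simp add: area_form_def)
      qed
      ultimately have "(1 - K (coord_t L p x)) * area_form L \<gamma> p x v w
          = ((1 - K r) * \<gamma> r) * (orient p * det2 v w / r)"
        by simp
      also have "\<dots> = (r * (2 * G 0 r + r * G 1 r)) * (orient p * det2 v w / r)"
        using f_1[OF r'] f1[of r] r' by simp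
      also have "\<dots> = ext_deriv \<beta> p x v w"
        unfolding ext using r' by simp
      finally show ?thesis ..
    qed
  qed
  ultimately have "\<beta> \<in> primitives L \<gamma>"
    by (simp add: primitives_def)
  moreover have "dual_norm L \<gamma> \<beta> p x \<le> 1" if x: "x \<in> ball 0 L" for p x
    unfolding dual_norm_def
  proof (rule cSUP_least)
    have "metric L \<gamma> p x 0 0 \<le> 1"
      by (simp add: metric_def form_dt_def form_dtheta_def det2_def)
    then show "{v. metric L \<gamma> p x v v \<le> 1} \<noteq> {}" by blast
  next
    fix v assume v: "v \<in> {v. metric L \<gamma> p x v v \<le> 1}"
    show "\<bar>\<beta> p x v\<bar> \<le> 1"
    proof (cases "x = 0")
      case True
      then show ?thesis by (simp add: \<beta> det2_def)
    next
      case False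
      define r where "r = norm x"
      have r: "r \<in> {0<..<L}" using x False by (auto simp: r_def)
      have \<gamma>r: "\<gamma> (coord_t L p x) = \<gamma> r"
        using symm[of r] r by (cases p) (simp_all add: coord_t_def flip: r_def)
      have "(form_dt p x v)\<^sup>2 + (\<gamma> r * form_dtheta x v)\<^sup>2 \<le> 1"
        using v False by (simp add: metric_def \<gamma>r power2_eq_square mult_ac)
      \<comment> \<open>Dropping the dt part leaves |d\<theta>(v)| \<le> 1/\<gamma>, so |f| \<le>
        \<gamma> gives the bound.\<close>
      then have "(\<gamma> r * form_dtheta x v)\<^sup>2 \<le> 1"
        using zero_le_power2[of "form_dt p x v"] by linarith
      then have le: "\<bar>\<gamma> r * form_dtheta x v\<bar> \<le> 1"
        by (simp add: abs_square_le_1)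
      have "\<bar>\<beta> p x v\<bar> = \<bar>f 0 r\<bar> * \<bar>form_dtheta x v\<bar>"
        using fG[of r] r by (cases p)
          (simp_all add: \<beta> orient_def form_dtheta_def abs_mult del: f.simps flip: r_def)
      also have "\<dots> \<le> \<gamma> r * \<bar>form_dtheta x v\<bar>"
        by (rule mult_right_mono[OF abs_f_le[OF r]]) simp
      also have "\<dots> \<le> 1"
        using le \<gamma>_pos[OF r] by (simp add: abs_mult)
      finally show ?thesis .
    qed
  qed
  ultimately show thesis using that by blast
qed

end

section \<open>One form bounding both infima\<close>

theorem proposition4p4:
  fixes L :: real and \<gamma> :: "real \<Rightarrow> real"
  assumes "normalized_profile L \<gamma>"
    and "\<And>t. t \<in> {0..L} \<Longrightarrow> \<gamma> t = \<gamma> (L - t)"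
    and "mono_on {0..L/2} (gauss_curvature L \<gamma>)"
  shows "m_value L \<gamma> \<le> 1 \<and> C_set L \<gamma> = {0<..}"
proof -
  interpret symmetric_profile L \<gamma>
    using assms by unfold_locales
  obtain \<beta> where \<beta>: "\<beta> \<in> primitives L \<gamma>"
      "\<And>p x. x \<in> ball 0 L \<Longrightarrow> dual_norm L \<gamma> \<beta> p x \<le> 1"
    using exists_primitive by blast
  have "m_value L \<gamma> \<le> 1"
    unfolding m_value_def
    by (rule INF_lower2[OF \<beta>(1)]) (auto intro!: SUP_least simp: \<beta>(2))
  moreover have "m \<in> C_set L \<gamma>" if m: "0 < m" for m
  proof -
    have "(INF \<beta>\<in>primitives L \<gamma>. SUP (p, x)\<in>UNIV \<times> ball 0 L.
        ereal (dual_norm L \<gamma> \<beta> p x - 1 / m)) \<le> ereal (1 - 1 / m)"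
      by (rule INF_lower2[OF \<beta>(1)]) (auto intro!: SUP_least simp: \<beta>(2))
    moreover have "1 - 1 / m < m"
    proof -
      \<comment> \<open>For m \<le> 1 the 1 dominates, for m > 1 the square does; dividing by m
        gives 1 < m + 1/m.\<close>
      have "m < 1 + m * m"
        using m by (smt (verit) mult_less_cancel_left2 mult_le_cancel_left1 mult_pos_pos)
      then show ?thesis using m by (simp add: field_simps)
    qed
    ultimately show ?thesis
      using m unfolding C_set_def by (simp add: le_less_trans[of _ "ereal (1 - 1 / m)"])
  qed
  moreover have "0 < m" if "m \<in> C_set L \<gamma>" for m
    using that unfolding C_set_def by blast
  ultimately show ?thesis
    unfolding set_eq_iff greaterThan_iff by blast
qed

end
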